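(* Let $T_{a,w}$ be a weighted translation on $L^p(G)$, $1\le p<\infty$, and let $A,B\subset\mathbb{N}$ with $\overline{\mathrm{dens}}(A)=\overline{\mathrm{dens}}(B)=1$. Suppose that $DIV_{A,B}=DIV_{A,B}(T_{a,w})$ is nonempty. Let $M_A\subseteq G$ be the measurable set, unique up to measure zero, such that $\overline{X_{0,A}}=L^p(M_A)$. Then $$\overline{DIV_{A,\bullet}}=\overline{DIV_{A,B}}=L^p(M_A)=\overline{X_{0,A}}.$$ In particular, the closure of $DIV$ is a union of closed subspaces of the form $L^p(M)$ for some measurable sets $M\subseteq G$. Furthermore, $DIV\cap L^p(M_A)$ is connected.
   Context: $G$ is a second countable locally compact Hausdorff group with a right invariant Haar measure $\lambda$; $L^p(G)$ is the complex Lebesgue space with respect to $\lambda$. For measurable $Y\subseteq G$, $L^p(Y)$ is identified with the closed subspace of $L^p(G)$ of functions vanishing a.e. outside $Y$. A weight on $G$ is a bounded continuous function $w:G\to(0,\infty)$. For $a\in G$, $(T_af)(x):=f(xa^{-1})$ and the weighted translation is $T_{a,w}f:=w\,T_af$ for $f\in L^p(G)$. For $A\subset\mathbb{N}=\{1,2,\dots\}$, $\overline{\mathrm{dens}}(A)=\limsup_{n\to\infty}\frac{\mathrm{card}(A\cap[1,n])}{n}$; $\lim_{n\in A}$ means the limit as $n\to\infty$ with $n\in A$. For $T=T_{a,w}$ on $X=L^p(G)$ and $A,B\subset\mathbb{N}$ with $\overline{\mathrm{dens}}(A)=\overline{\mathrm{dens}}(B)=1$, define $X_{0,A}=\{x\in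 X:\lim_{n\in A}T^nx=0\}$ and $DIV_{A,B}=\{x\in X:\lim_{n\in A}T^nx=0\text{ and }\lim_{n\in B}\|T^nx\|=\infty\}$. $DIV$ is the set of all distributionally irregular vectors, i.e. the union of all $DIV_{A,B}$ over such $A,B$, and $DIV_{A,\bullet}:=DIV\cap X_{0,A}=\bigcup_{\overline{\mathrm{dens}}(B')=1}DIV_{A,B'}$. Closures and connectedness are in the norm topology. A measurable set $M_A$ with $\overline{X_{0,A}}=L^p(M_A)$ always exists and is unique up to measure zero. *)

theory Defs
  imports "HOL-Analysis.Analysis"
begin

text \<open>
  The group is written additively, following the library class of topological groups:
  \<open>group_add\<close> is not commutative. Thus \<open>x + a\<close> stands for $xa$ and \<open>x - a\<close>
  for $xa^{-1}$.
\<close>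

section \<open>Right Haar measures and weights\<close>

text \<open>A nonzero right invariant Radon measure on the Borel sets. In a second countable locally
  compact Hausdorff group the two regularity clauses follow from the remaining ones.\<close>

definition right_haar_measure :: "'a::{topological_group_add, t2_space} measure \<Rightarrow> bool" where
  "right_haar_measure M \<longleftrightarrow>
     sets M = sets borel \<and>
     emeasure M UNIV \<noteq> 0 \<and>
     (\<forall>K. compact K \<longrightarrow> emeasure M K < \<infinity>) \<and>
     (\<forall>E \<in> sets borel. emeasure M E = (INF U \<in> {U. open U \<and> E \<subseteq> U}. emeasure M U)) \<and>
     (\<forall>U. open U \<longrightarrow> emeasure M U = (SUP K \<in> {K. compact K \<and> K \<subseteq> U}. emeasure M K)) \<and>
     (\<forall>E \<in> sets borel. \<forall>a. emeasure M ((\<lambda>x. x + a) ` E) = emeasure M E)"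

definition weight :: "('a::topological_space \<Rightarrow> real) \<Rightarrow> bool" where
  "weight w \<longleftrightarrow> continuous_on UNIV w \<and> bounded (range w) \<and> (\<forall>x. 0 < w x)"


section \<open>Complex Lebesgue spaces\<close>

text \<open>Elements of $L^p$ are classes of functions modulo equality almost everywhere.\<close>

definition Lp_fun :: "'a measure \<Rightarrow> real \<Rightarrow> ('a \<Rightarrow> complex) set" where
  "Lp_fun M p = {f \<in> borel_measurable M. integrable M (\<lambda>x. norm (f x) powr p)}"

definition Lp_rel :: "'a measure \<Rightarrow> real \<Rightarrow> (('a \<Rightarrow> complex) \<times> ('a \<Rightarrow> complex)) set" where
  "Lp_rel M p = {(f, g). f \<in> Lp_fun M p \<and> g \<in> Lp_fun M p \<and> (AE x in M. f x = g x)}"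

definition Lp :: "'a measure \<Rightarrow> real \<Rightarrow> ('a \<Rightarrow> complex) set set" where
  "Lp M p = Lp_fun M p // Lp_rel M p"

definition Lp_zero :: "'a measure \<Rightarrow> real \<Rightarrow> ('a \<Rightarrow> complex) set" where
  "Lp_zero M p = Lp_rel M p `` {\<lambda>x. 0}"

definition Lp_diff ::
  "'a measure \<Rightarrow> real \<Rightarrow> ('a \<Rightarrow> complex) set \<Rightarrow> ('a \<Rightarrow> complex) set \<Rightarrow> ('a \<Rightarrow> complex) set" where
  "Lp_diff M p C D = Lp_rel M p `` {(\<lambda>x. f x - g x) | f g. f \<in> C \<and> g \<in> D}"

definition Lp_fun_norm :: "'a measure \<Rightarrow> real \<Rightarrow> ('a \<Rightarrow> complex) \<Rightarrow> real" where
  "Lp_fun_norm M p f = (\<integral>x. norm (f x) powr p \<partial>M) powr (1 / p)"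

definition Lp_norm :: "'a measure \<Rightarrow> real \<Rightarrow> ('a \<Rightarrow> complex) set \<Rightarrow> real" where
  "Lp_norm M p C = Lp_fun_norm M p (SOME f. f \<in> C)"

text \<open>The value outside of \<open>Lp M p\<close> is irrelevant, but \<^locale>\<open>Metric_space\<close> demands symmetry
  of the distance on the whole type.\<close>

definition Lp_dist ::
  "'a measure \<Rightarrow> real \<Rightarrow> ('a \<Rightarrow> complex) set \<Rightarrow> ('a \<Rightarrow> complex) set \<Rightarrow> real" where
  "Lp_dist M p C D =
     (if C \<in> Lp M p \<and> D \<in> Lp M p then Lp_norm M p (Lp_diff M p C D) else 0)"

definition Lp_topology :: "'a measure \<Rightarrow> real \<Rightarrow> ('a \<Rightarrow> complex) set topology" where
  "Lp_topology M p = Metric_space.mtopology (Lp M p) (Lp_dist M p)"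

text \<open>$L^p(Y)$ as a subspace of $L^p(G)$.\<close>

definition Lp_on :: "'a measure \<Rightarrow> real \<Rightarrow> 'a set \<Rightarrow> ('a \<Rightarrow> complex) set set" where
  "Lp_on M p Y = {C \<in> Lp M p. \<forall>f \<in> C. AE x in M. x \<notin> Y \<longrightarrow> f x = 0}"


section \<open>Weighted translations\<close>

definition weighted_translation ::
  "'a measure \<Rightarrow> real \<Rightarrow> 'a::group_add \<Rightarrow> ('a \<Rightarrow> real) \<Rightarrow> ('a \<Rightarrow> complex) set \<Rightarrow> ('a \<Rightarrow> complex) set"
where
  "weighted_translation M p a w C =
     Lp_rel M p `` ((\<lambda>f x. complex_of_real (w x) * f (x - a)) ` C)"


section \<open>Distributional irregularity\<close>

definition upper_density :: "nat set \<Rightarrow> ereal" where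
  "upper_density A = limsup (\<lambda>n. ereal (real (card (A \<inter> {1..n})) / real n))"

definition full_upper_density :: "nat set \<Rightarrow> bool" where
  "full_upper_density A \<longleftrightarrow> A \<subseteq> {1..} \<and> upper_density A = 1"

text \<open>Limits along \<open>A\<close>: $n \to \infty$ with $n \in A$.\<close>

abbreviation along :: "nat set \<Rightarrow> nat filter" where
  "along A \<equiv> inf sequentially (principal A)"

definition X0 ::
  "'a measure \<Rightarrow> real \<Rightarrow> (('a \<Rightarrow> complex) set \<Rightarrow> ('a \<Rightarrow> complex) set) \<Rightarrow> nat set
    \<Rightarrow> ('a \<Rightarrow> complex) set set" where
  "X0 M p T A =
     {C \<in> Lp M p. limitin (Lp_topology M p) (\<lambda>n. (T ^^ n) C) (Lp_zero M p) (along A)}"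

definition DIV_pair ::
  "'a measure \<Rightarrow> real \<Rightarrow> (('a \<Rightarrow> complex) set \<Rightarrow> ('a \<Rightarrow> complex) set) \<Rightarrow> nat set \<Rightarrow> nat set
    \<Rightarrow> ('a \<Rightarrow> complex) set set" where
  "DIV_pair M p T A B =
     {C \<in> Lp M p.
        limitin (Lp_topology M p) (\<lambda>n. (T ^^ n) C) (Lp_zero M p) (along A) \<and>
        filterlim (\<lambda>n. Lp_norm M p ((T ^^ n) C)) at_top (along B)}"

definition DIV ::
  "'a measure \<Rightarrow> real \<Rightarrow> (('a \<Rightarrow> complex) set \<Rightarrow> ('a \<Rightarrow> complex) set)
    \<Rightarrow> ('a \<Rightarrow> complex) set set" where
  "DIV M p T =
     \<Union> {DIV_pair M p T A B | A B. full_upper_density A \<and> full_upper_density B}"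

definition DIV_left ::
  "'a measure \<Rightarrow> real \<Rightarrow> (('a \<Rightarrow> complex) set \<Rightarrow> ('a \<Rightarrow> complex) set) \<Rightarrow> nat set
    \<Rightarrow> ('a \<Rightarrow> complex) set set" where
  "DIV_left M p T A = DIV M p T \<inter> X0 M p T A"

end

theory Submission
  imports Defs
begin

text \<open>
  An iterate of a weighted translation is, at each point, evaluation at another point times a
  nonnegative scalar. Hence pointwise inequalities between moduli of functions pass to the norms
  along the orbits: a function dominated by members of \<open>X\<^sub>0\<^sub>,\<^sub>A\<close> is in \<open>X\<^sub>0\<^sub>,\<^sub>A\<close>
  (\<open>X0_dominated\<close>), and one that in addition dominates a positive multiple of a member of
  \<open>DIV\<^sub>A\<^sub>,\<^sub>B\<close> is in \<open>DIV\<^sub>A\<^sub>,\<^sub>B\<close> (\<open>DIV_pair_squeeze\<close>). Phases are therefore free to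
  choose, and every part of the theorem comes from a good choice.

  \<^bold>\<open>Density.\<close> Fix \<open>f\<close> in \<open>DIV\<^sub>A\<^sub>,\<^sub>B\<close> and let \<open>g\<close> be in \<open>X\<^sub>0\<^sub>,\<^sub>A\<close>. If the sign of the
  perturbation \<open>\<plusminus>\<epsilon>\<bar>f\<bar>\<close> is that of the real part of \<open>g\<close>, no cancellation occurs, the sum has
  modulus at least \<open>\<epsilon>\<bar>f\<bar>\<close>, and so it lies in \<open>DIV\<^sub>A\<^sub>,\<^sub>B\<close>
  (\<open>X0_subset_closure_DIV_pair\<close>). The sets \<open>DIV\<^sub>A\<^sub>,\<^sub>B\<close>, \<open>DIV\<^sub>A\<^sub>,\<^sub>\<bullet>\<close> and \<open>X\<^sub>0\<^sub>,\<^sub>A\<close> increase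
  in this order, so their closures agree.

  \<^bold>\<open>The closure of all irregular vectors.\<close> It is the union of \<open>L\<^sup>p(supp f)\<close> over its members
  \<open>f\<close>. Truncation reduces the claim that it contains \<open>L\<^sup>p(supp f)\<close> to functions \<open>g\<close> with
  \<open>\<bar>g\<bar> \<le> K\<bar>f\<bar>\<close>. When irregular \<open>h\<close> approximate \<open>f\<close>, lowering the modulus of \<open>g\<close> to at most
  \<open>K\<bar>h\<bar>\<close> changes \<open>g\<close> by at most \<open>K\<bar>f - h\<bar>\<close> and leads into some \<open>X\<^sub>0\<^sub>,\<^sub>A\<close>, which the density
  argument puts into the closure (\<open>closure_DIV_dominated\<close>, \<open>Lp_on_support_subset\<close>).

  \<^bold>\<open>Connectedness.\<close> Any \<open>f\<close> and \<open>g\<close> in \<open>DIV\<^sub>A\<^sub>,\<^sub>B\<close> are joined inside it through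
  \<open>h = \<bar>f\<bar> + \<bar>g\<bar>\<close>, by segments from \<open>f\<close> to \<open>\<plusminus>i h\<close> and on to \<open>h\<close>: at every point the
  directions of the end points differ by at most a right angle, so the segments stay away from zero
  (\<open>connected_component_majorant\<close>). A set between the connected set \<open>DIV\<^sub>A\<^sub>,\<^sub>B\<close> and its closure
  is connected, and \<open>DIV \<inter> L\<^sup>p(M)\<close> is such a set.
\<close>

section \<open>The Lebesgue metric\<close>

text \<open>Convexity on the open half line comes from the second derivative; the boundary point
  needs \<open>s powr p \<le> s\<close> for \<open>s \<le> 1\<close>.\<close>

lemma powr_convex_nonneg:
  fixes x y t p :: real
  assumes "1 \<le> p" "0 \<le> x" "0 \<le> y" "0 \<le> t" "t \<le> 1"
  shows "((1 - t) * x + t * y) powr p \<le> (1 - t) * x powr p + t * y powr p"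
proof -
  have scale: "(s * z) powr p \<le> s * z powr p" if "0 \<le> s" "s \<le> 1" "0 \<le> z" for s z :: real
  proof (cases "s = 0")
    case False
    then have "s powr p \<le> s powr 1"
      using that assms by (intro powr_mono') auto
    then show ?thesis
      using that by (simp add: powr_mult mult_right_mono)
  qed simp
  show ?thesis
  proof (cases "x = 0 \<or> y = 0")
    case True
    then show ?thesis
      using scale[of t y] scale[of "1 - t" x] assms by auto
  next
    case False
    then show ?thesis
      using convex_onD[OF powr_convex[OF assms(1)], of t x y] assms by simp
  qed
qed

locale Lp_space =
  fixes M :: "'a measure" and p :: real
  assumes one_le_p: "1 \<le> p"
begin

abbreviation nrm :: "('a \<Rightarrow> complex) \<Rightarrow> real" where
  "nrm \<equiv> Lp_fun_norm M p"

abbreviation cls :: "('a \<Rightarrow> complex) \<Rightarrow> ('a \<Rightarrow> complex) set" where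
  "cls f \<equiv> Lp_rel M p `` {f}"

lemma Lp_fun_measurable: "f \<in> Lp_fun M p \<Longrightarrow> f \<in> borel_measurable M"
  by (simp add: Lp_fun_def)

lemma Lp_fun_integrable: "f \<in> Lp_fun M p \<Longrightarrow> integrable M (\<lambda>x. norm (f x) powr p)"
  by (simp add: Lp_fun_def)

lemma Lp_fun_zero: "(\<lambda>x. 0) \<in> Lp_fun M p"
  by (simp add: Lp_fun_def)

lemma nrm_nonneg [simp]: "0 \<le> nrm f"
  by (simp add: Lp_fun_norm_def)

lemma nrm_powr: "nrm f powr p = (\<integral>x. norm (f x) powr p \<partial>M)"
  using one_le_p by (simp add: Lp_fun_norm_def powr_powr integral_nonneg_AE)

lemma nrm_cong: "(\<And>x. norm (f x) = norm (g x)) \<Longrightarrow> nrm f = nrm g"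
  by (simp add: Lp_fun_norm_def)

lemma scale_Lp:
  assumes f: "f \<in> Lp_fun M p"
  shows "(\<lambda>x. of_real c * f x) \<in> Lp_fun M p"
    and "nrm (\<lambda>x. of_real c * f x) = \<bar>c\<bar> * nrm f"
proof -
  have *: "(\<lambda>x. norm (of_real c * f x) powr p) = (\<lambda>x. \<bar>c\<bar> powr p * norm (f x) powr p)"
    by (simp add: norm_mult powr_mult)
  show "(\<lambda>x. of_real c * f x) \<in> Lp_fun M p"
    using f by (auto simp: Lp_fun_def *)
  have "nrm (\<lambda>x. of_real c * f x) = (\<bar>c\<bar> powr p * (nrm f) powr p) powr (1 / p)"
    unfolding nrm_powr by (simp only: Lp_fun_norm_def *) simp
  also have "\<dots> = \<bar>c\<bar> * nrm f"
    using one_le_p by (simp add: powr_mult powr_powr)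
  finally show "nrm (\<lambda>x. of_real c * f x) = \<bar>c\<bar> * nrm f" .
qed

text \<open>The triangle inequality is stated for any \<open>k\<close> with \<open>\<bar>k\<bar> \<le> \<bar>f\<bar> + \<bar>g\<bar>\<close>, so that it also serves as a
  comparison principle. For \<open>a\<close> and \<open>b\<close> above the norms of \<open>f\<close> and \<open>g\<close>, the sum
  \<open>\<bar>f\<bar> + \<bar>g\<bar>\<close> is \<open>a + b\<close> times a convex combination of \<open>\<bar>f\<bar> / a\<close> and \<open>\<bar>g\<bar> / b\<close>, and
  convexity of the power bounds the integral by \<open>(a + b) powr p\<close>.\<close>

lemma Minkowski:
  assumes f: "f \<in> Lp_fun M p" and g: "g \<in> Lp_fun M p" and k: "k \<in> borel_measurable M"
    and le: "\<And>x. norm (k x) \<le> norm (f x) + norm (g x)"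
  shows "k \<in> Lp_fun M p" and "nrm k \<le> nrm f + nrm g"
proof -
  define H where "H a b x = (a + b) powr p *
      (a / (a + b) * (norm (f x) powr p / a powr p) + b / (a + b) * (norm (g x) powr p / b powr p))"
    for a b :: real and x
  have H_int: "integrable M (H a b)" for a b
    unfolding H_def using f g by (simp add: Lp_fun_def)
  have H_ge: "norm (k x) powr p \<le> H a b x" if "0 < a" "0 < b" for a b x
  proof -
    have w: "1 - b / (a + b) = a / (a + b)"
      using that by (simp add: field_simps)
    have "norm (k x) powr p \<le> (norm (f x) + norm (g x)) powr p"
      using le one_le_p by (intro powr_mono2) auto
    also have "norm (f x) + norm (g x) =
        (a + b) * ((1 - b / (a + b)) * (norm (f x) / a) + b / (a + b) * (norm (g x) / b))"
      using that by (simp add: w distrib_left)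
    also have "\<dots> powr p = (a + b) powr p *
        ((1 - b / (a + b)) * (norm (f x) / a) + b / (a + b) * (norm (g x) / b)) powr p"
      by (rule powr_mult)
    also have "\<dots> \<le> (a + b) powr p *
        ((1 - b / (a + b)) * (norm (f x) / a) powr p + b / (a + b) * (norm (g x) / b) powr p)"
      using that one_le_p by (intro mult_left_mono powr_convex_nonneg) auto
    also have "\<dots> = H a b x"
      unfolding H_def w by (simp only: powr_divide)
    finally show ?thesis .
  qed
  have k_int: "integrable M (\<lambda>x. norm (k x) powr p)"
    by (rule Bochner_Integration.integrable_bound[OF H_int[of 1 1]])
      (use k H_ge[of 1 1] order_trans[OF _ abs_ge_self] in auto)
  then show "k \<in> Lp_fun M p"
    using k by (simp add: Lp_fun_def)
  show "nrm k \<le> nrm f + nrm g"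
  proof (rule field_le_epsilon)
    fix e :: real assume "0 < e"
    \<comment> \<open>The enlarged bounds are positive even when a norm is zero.\<close>
    define a b where "a = nrm f + e / 2" and "b = nrm g + e / 2"
    have ab: "0 < a" "0 < b" "nrm f \<le> a" "nrm g \<le> b"
      using \<open>0 < e\<close> by (auto simp: a_def b_def add_nonneg_pos)
    have "nrm k powr p \<le> integral\<^sup>L M (H a b)"
      unfolding nrm_powr using k_int H_int H_ge ab by (intro integral_mono) auto
    also have "\<dots> = (a + b) powr p *
        (a / (a + b) * (nrm f powr p / a powr p) + b / (a + b) * (nrm g powr p / b powr p))"
      unfolding H_def nrm_powr using f g by (simp add: Lp_fun_def)
    also have "\<dots> \<le> (a + b) powr p * (a / (a + b) * 1 + b / (a + b) * 1)"
      using ab one_le_p by (intro mult_left_mono add_mono) (auto intro: powr_mono2)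
    also have "\<dots> = (a + b) powr p"
      using ab by (simp flip: add_divide_distrib)
    finally have "nrm k powr p \<le> (a + b) powr p" .
    then have "nrm k \<le> a + b"
      using one_le_p ab by (smt (verit) nrm_nonneg powr_less_mono2)
    then show "nrm k \<le> nrm f + nrm g + e"
      by (simp add: a_def b_def)
  qed
qed

lemma dominated_Lp:
  assumes f: "f \<in> Lp_fun M p" and g: "g \<in> Lp_fun M p" and k: "k \<in> borel_measurable M"
    and c: "0 \<le> c" "0 \<le> d"
    and le: "\<And>x. norm (k x) \<le> c * norm (f x) + d * norm (g x)"
  shows "k \<in> Lp_fun M p" and "nrm k \<le> c * nrm f + d * nrm g"
  using Minkowski[OF scale_Lp(1)[OF f, of c] scale_Lp(1)[OF g, of d] k]
    scale_Lp(2)[OF f, of c] scale_Lp(2)[OF g, of d] c le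
  by (auto simp: norm_mult)

lemma dominated_Lp1:
  assumes f: "f \<in> Lp_fun M p" and k: "k \<in> borel_measurable M"
    and c: "0 \<le> c" and le: "\<And>x. norm (k x) \<le> c * norm (f x)"
  shows "k \<in> Lp_fun M p" and "nrm k \<le> c * nrm f"
  using dominated_Lp[OF f f k c, of 0] le by auto

lemma diff_Lp:
  assumes "f \<in> Lp_fun M p" "g \<in> Lp_fun M p"
  shows "(\<lambda>x. f x - g x) \<in> Lp_fun M p"
proof (rule Minkowski(1)[OF assms])
  show "(\<lambda>x. f x - g x) \<in> borel_measurable M"
    using assms by (auto simp: Lp_fun_def)
qed (rule norm_triangle_ineq4)

lemma nrm_cong_AE:
  assumes "f \<in> Lp_fun M p" "g \<in> Lp_fun M p" "AE x in M. f x = g x"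
  shows "nrm f = nrm g"
  unfolding Lp_fun_norm_def
  using assms by (intro arg_cong[where f = "\<lambda>u. u powr (1 / p)"] integral_cong_AE)
    (auto simp: Lp_fun_def)

lemma nrm_eq_0_iff:
  assumes "f \<in> Lp_fun M p"
  shows "nrm f = 0 \<longleftrightarrow> (AE x in M. f x = 0)"
proof -
  have "nrm f = 0 \<longleftrightarrow> nrm f powr p = 0"
    by simp
  also have "\<dots> \<longleftrightarrow> (AE x in M. norm (f x) powr p = 0)"
    unfolding nrm_powr using assms by (intro integral_nonneg_eq_0_iff_AE) (auto simp: Lp_fun_def)
  finally show ?thesis
    by simp
qed

lemma equiv_Lp_rel: "equiv (Lp_fun M p) (Lp_rel M p)"
  by (rule equivI) (auto simp: Lp_rel_def refl_on_def sym_def trans_def elim: eventually_elim2)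

lemma Lp_rel_iff: "(f, g) \<in> Lp_rel M p \<longleftrightarrow> f \<in> Lp_fun M p \<and> g \<in> Lp_fun M p \<and> (AE x in M. f x = g x)"
  by (simp add: Lp_rel_def)

lemma cls_in_Lp [simp]: "f \<in> Lp_fun M p \<Longrightarrow> cls f \<in> Lp M p"
  by (simp add: Lp_def quotientI)

lemma LpE:
  assumes "C \<in> Lp M p"
  obtains f where "f \<in> Lp_fun M p" "C = cls f"
  using assms by (auto simp: Lp_def elim: quotientE)

lemma subset_LpE:
  assumes "C \<in> S" "S \<subseteq> Lp M p"
  obtains f where "f \<in> Lp_fun M p" "C = cls f"
  using assms by (blast elim: LpE)

lemma cls_eq_iff:
  "f \<in> Lp_fun M p \<Longrightarrow> g \<in> Lp_fun M p \<Longrightarrow> cls f = cls g \<longleftrightarrow> (AE x in M. f x = g x)"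
  using eq_equiv_class_iff[OF equiv_Lp_rel, of f g] by (simp add: Lp_rel_def)

text \<open>The set-level operations of difference and translation return the relational image of a set of
  representatives; this identifies the image as one class.\<close>

lemma cls_of_subset:
  assumes "f \<in> S" "\<And>g. g \<in> S \<Longrightarrow> g \<in> cls f"
  shows "Lp_rel M p `` S = cls f"
proof
  have "trans (Lp_rel M p)"
    using equiv_Lp_rel by (auto simp: equiv_def)
  then show "Lp_rel M p `` S \<subseteq> cls f"
    using assms(2) by (fastforce dest: transD)
qed (use assms(1) in auto)

lemma Lp_norm_cls: "f \<in> Lp_fun M p \<Longrightarrow> Lp_norm M p (cls f) = nrm f"
  unfolding Lp_norm_def
  by (rule someI2[of _ f]) (auto simp: Lp_rel_iff intro: nrm_cong_AE[symmetric])

lemma Lp_diff_cls: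
  assumes f: "f \<in> Lp_fun M p" and g: "g \<in> Lp_fun M p"
  shows "Lp_diff M p (cls f) (cls g) = cls (\<lambda>x. f x - g x)"
  unfolding Lp_diff_def
proof (rule cls_of_subset)
  show "(\<lambda>x. f x - g x) \<in> {(\<lambda>x. f' x - g' x) |f' g'. f' \<in> cls f \<and> g' \<in> cls g}"
    using f g by (auto simp: Lp_rel_iff)
  fix h assume "h \<in> {(\<lambda>x. f' x - g' x) |f' g'. f' \<in> cls f \<and> g' \<in> cls g}"
  then obtain f' g' where h: "h = (\<lambda>x. f' x - g' x)" and "f' \<in> cls f" "g' \<in> cls g"
    by auto
  then have *: "f' \<in> Lp_fun M p" "g' \<in> Lp_fun M p" "AE x in M. f x = f' x" "AE x in M. g x = g' x"
    by (auto simp: Lp_rel_iff)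
  from *(3,4) have "AE x in M. f x - g x = h x"
    by eventually_elim (simp add: h)
  then show "h \<in> cls (\<lambda>x. f x - g x)"
    using f g * by (simp add: Lp_rel_iff diff_Lp h)
qed

lemma Lp_dist_cls:
  "f \<in> Lp_fun M p \<Longrightarrow> g \<in> Lp_fun M p \<Longrightarrow>
    Lp_dist M p (cls f) (cls g) = nrm (\<lambda>x. f x - g x)"
  by (simp add: Lp_dist_def Lp_diff_cls Lp_norm_cls diff_Lp)

lemma nrm_diff_commute: "nrm (\<lambda>x. f x - g x) = nrm (\<lambda>x. g x - f x)"
  by (rule nrm_cong) (rule norm_minus_commute)

lemma nrm_triangle_diff:
  assumes "f \<in> Lp_fun M p" "g \<in> Lp_fun M p" "h \<in> Lp_fun M p"
  shows "nrm (\<lambda>x. f x - h x) \<le> nrm (\<lambda>x. f x - g x) + nrm (\<lambda>x. g x - h x)"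
proof (rule Minkowski(2))
  fix x
  show "norm (f x - h x) \<le> norm (f x - g x) + norm (g x - h x)"
    using norm_triangle_ineq[of "f x - g x" "g x - h x"] by simp
qed (use assms in \<open>auto simp: diff_Lp intro: Lp_fun_measurable\<close>)

sublocale Lpm: Metric_space "Lp M p" "Lp_dist M p"
proof
  fix C D
  show "0 \<le> Lp_dist M p C D"
    by (auto simp: Lp_dist_def Lp_norm_def)
  show "Lp_dist M p C D = Lp_dist M p D C"
  proof (cases "C \<in> Lp M p \<and> D \<in> Lp M p")
    case True
    then obtain f g where "f \<in> Lp_fun M p" "C = cls f" "g \<in> Lp_fun M p" "D = cls g"
      by (metis LpE)
    then show ?thesis
      using nrm_diff_commute[of f g] by (simp add: Lp_dist_cls)
  qed (auto simp: Lp_dist_def)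
  assume "C \<in> Lp M p" and D: "D \<in> Lp M p"
  then obtain f g where fg: "f \<in> Lp_fun M p" "C = cls f" "g \<in> Lp_fun M p" "D = cls g"
    by (metis LpE)
  show "Lp_dist M p C D = 0 \<longleftrightarrow> C = D"
    using fg by (simp add: Lp_dist_cls nrm_eq_0_iff diff_Lp cls_eq_iff)
  fix E assume "E \<in> Lp M p"
  then obtain h where "h \<in> Lp_fun M p" "E = cls h"
    by (metis LpE)
  then show "Lp_dist M p C E \<le> Lp_dist M p C D + Lp_dist M p D E"
    using fg nrm_triangle_diff by (simp add: Lp_dist_cls)
qed

lemma Lp_zero_cls: "Lp_zero M p = cls (\<lambda>x. 0)"
  by (simp add: Lp_zero_def)

lemma topspace_Lp [simp]: "topspace (Lp_topology M p) = Lp M p"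
  by (simp add: Lp_topology_def)

lemma closure_subset_Lp: "Lp_topology M p closure_of S \<subseteq> Lp M p"
  using closure_of_subset_topspace[of "Lp_topology M p" S] by simp

lemma in_closure_cls_iff:
  assumes f: "f \<in> Lp_fun M p" and S: "S \<subseteq> Lp M p"
  shows "cls f \<in> Lp_topology M p closure_of S \<longleftrightarrow>
    (\<forall>r>0. \<exists>g \<in> Lp_fun M p. cls g \<in> S \<and> nrm (\<lambda>x. f x - g x) < r)" (is "?l \<longleftrightarrow> ?r")
proof
  assume ?l
  show ?r
  proof (intro allI impI)
    fix r :: real assume "0 < r"
    with \<open>?l\<close> obtain D where "D \<in> S" "Lp_dist M p (cls f) D < r"
      by (auto simp: Lp_topology_def Lpm.metric_closure_of)
    moreover obtain g where "g \<in> Lp_fun M p" "D = cls g"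
      using \<open>D \<in> S\<close> S LpE by blast
    ultimately show "\<exists>g \<in> Lp_fun M p. cls g \<in> S \<and> nrm (\<lambda>x. f x - g x) < r"
      using f by (auto simp: Lp_dist_cls)
  qed
next
  assume r: ?r
  have "\<exists>D \<in> S. D \<in> Lpm.mball (cls f) e" if "0 < e" for e
  proof -
    obtain g where "g \<in> Lp_fun M p" "cls g \<in> S" "nrm (\<lambda>x. f x - g x) < e"
      using r \<open>0 < e\<close> by blast
    then show ?thesis
      using f by (intro bexI[of _ "cls g"]) (auto simp: Lp_dist_cls)
  qed
  then show ?l
    using f by (simp add: Lp_topology_def Lpm.metric_closure_of)
qed

lemma closure_subset_closure:
  "S \<subseteq> Lp_topology M p closure_of T \<Longrightarrow>
    Lp_topology M p closure_of S \<subseteq> Lp_topology M p closure_of T"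
  by (simp add: closure_of_minimal)

text \<open>The segment is a Lipschitz image of \<open>[0, 1]\<close>.\<close>

lemma segment_connected:
  assumes f: "f \<in> Lp_fun M p" and g: "g \<in> Lp_fun M p"
  shows "connectedin (Lp_topology M p)
    ((\<lambda>t. cls (\<lambda>x. of_real (1 - t) * f x + of_real t * g x)) ` {0..1})"
proof (rule connectedin_continuous_map_image[of euclideanreal])
  define seg where "seg t = (\<lambda>x. of_real (1 - t) * f x + of_real t * g x)" for t :: real
  have seg: "seg t \<in> Lp_fun M p" for t
  proof (rule dominated_Lp(1)[OF f g])
    show "seg t \<in> borel_measurable M"
      using f g unfolding seg_def by (auto dest!: Lp_fun_measurable)
    show "norm (seg t x) \<le> \<bar>1 - t\<bar> * norm (f x) + \<bar>t\<bar> * norm (g x)" for x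
      unfolding seg_def by (rule norm_triangle_le) (simp add: norm_mult flip: of_real_diff)
  qed auto
  have dist: "Lp_dist M p (cls (seg s)) (cls (seg t)) = \<bar>s - t\<bar> * nrm (\<lambda>x. g x - f x)" for s t
  proof -
    have "(\<lambda>x. seg s x - seg t x) = (\<lambda>x. of_real (s - t) * (g x - f x))"
      by (auto simp: seg_def algebra_simps)
    then show ?thesis
      using seg scale_Lp(2)[OF diff_Lp[OF g f], of "s - t"] by (simp add: Lp_dist_cls)
  qed
  have "continuous_map Met_TC.mtopology Lpm.mtopology (\<lambda>t. cls (seg t))"
    unfolding Met_TC.metric_continuous_map[OF Lpm.Metric_space_axioms]
  proof (intro conjI ballI allI impI)
    fix s e :: real assume "0 < e"
    show "\<exists>d>0. \<forall>t. t \<in> UNIV \<and> dist s t < d \<longrightarrow> Lp_dist M p (cls (seg s)) (cls (seg t)) < e"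
    proof (intro exI[of _ "e / (nrm (\<lambda>x. g x - f x) + 1)"] conjI allI impI)
      show "0 < e / (nrm (\<lambda>x. g x - f x) + 1)"
        using \<open>0 < e\<close> by (simp add: add_nonneg_pos)
      fix t assume "t \<in> UNIV \<and> dist s t < e / (nrm (\<lambda>x. g x - f x) + 1)"
      then have "\<bar>s - t\<bar> * (nrm (\<lambda>x. g x - f x) + 1) < e"
        by (simp add: dist_real_def pos_less_divide_eq add_nonneg_pos)
      moreover have "\<bar>s - t\<bar> * nrm (\<lambda>x. g x - f x) \<le> \<bar>s - t\<bar> * (nrm (\<lambda>x. g x - f x) + 1)"
        by (intro mult_left_mono) auto
      ultimately show "Lp_dist M p (cls (seg s)) (cls (seg t)) < e"
        by (simp add: dist)
    qed
  qed (use seg in auto)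
  then show "continuous_map euclideanreal (Lp_topology M p)
      (\<lambda>t. cls (\<lambda>x. of_real (1 - t) * f x + of_real t * g x))"
    by (simp add: Lp_topology_def seg_def)
qed (simp add: connectedin_iff_connected)

text \<open>Almost everywhere the truncation is eventually equal to \<open>g\<close>, since \<open>g\<close> vanishes where \<open>f\<close>
  does; dominated convergence with majorant \<open>\<bar>g\<bar>\<close> does the rest.\<close>

lemma truncation_tendsto:
  assumes f: "f \<in> Lp_fun M p" and g: "g \<in> Lp_fun M p"
    and supp: "AE x in M. f x = 0 \<longrightarrow> g x = 0"
  defines "tr \<equiv> \<lambda>n x. if norm (g x) \<le> real n * norm (f x) then g x else 0"
  shows "tr n \<in> Lp_fun M p" and "(\<lambda>n. nrm (\<lambda>x. g x - tr n x)) \<longlonglongrightarrow> 0"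
proof -
  have [measurable]: "f \<in> borel_measurable M" "g \<in> borel_measurable M"
    using f g by (auto intro: Lp_fun_measurable)
  have [measurable]: "tr n \<in> borel_measurable M" for n
    unfolding tr_def by measurable
  show "tr n \<in> Lp_fun M p"
    by (rule dominated_Lp1(1)[OF g, of _ 1]) (auto simp: tr_def)
  have "(\<lambda>n. \<integral>x. norm (g x - tr n x) powr p \<partial>M) \<longlonglongrightarrow> (\<integral>x. 0 \<partial>M)"
  proof (rule integral_dominated_convergence[where w = "\<lambda>x. norm (g x) powr p"])
    show "AE x in M. (\<lambda>n. norm (g x - tr n x) powr p) \<longlonglongrightarrow> 0"
      using supp
    proof eventually_elim
      fix x assume x: "f x = 0 \<longrightarrow> g x = 0"
      have "\<forall>\<^sub>F n in sequentially. norm (g x) \<le> real n * norm (f x)"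
      proof (cases "f x = 0")
        case False
        then have "\<forall>\<^sub>F n in sequentially. norm (g x) / norm (f x) \<le> real n"
          using eventually_ge_at_top[of "nat \<lceil>norm (g x) / norm (f x)\<rceil>"]
          by (auto elim!: eventually_mono simp: nat_ceiling_le_eq)
        then show ?thesis
          using False by (simp add: pos_divide_le_eq)
      qed (use x in simp)
      then have "\<forall>\<^sub>F n in sequentially. norm (g x - tr n x) powr p = 0"
        by eventually_elim (simp add: tr_def)
      then show "(\<lambda>n. norm (g x - tr n x) powr p) \<longlonglongrightarrow> 0"
        by (rule tendsto_eventually)
    qed
    show "AE x in M. norm (norm (g x - tr n x) powr p) \<le> norm (g x) powr p" for n
      by (auto simp: tr_def)
  qed (use g in \<open>auto intro: Lp_fun_integrable\<close>)
  then show "(\<lambda>n. nrm (\<lambda>x. g x - tr n x)) \<longlonglongrightarrow> 0"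
    unfolding Lp_fun_norm_def using one_le_p
    by (intro tendsto_zero_powrI[where b = "1 / p"]) auto
qed

end


section \<open>Orbits of weighted translations\<close>

locale weighted_shift = Lp_space M p
  for M :: "'a::{topological_group_add, t2_space, second_countable_topology} measure" and p +
  fixes a :: 'a and w :: "'a \<Rightarrow> real"
  assumes haar: "right_haar_measure M" and weight: "weight w"
begin

definition shift :: "('a \<Rightarrow> complex) \<Rightarrow> 'a \<Rightarrow> complex" where
  "shift f = (\<lambda>x. complex_of_real (w x) * f (x - a))"

lemma shift_apply: "shift f x = complex_of_real (w x) * f (x - a)"
  by (simp add: shift_def)

abbreviation T where
  "T \<equiv> weighted_translation M p a w"

abbreviation orbit_norm where
  "orbit_norm f \<equiv> \<lambda>n. nrm ((shift ^^ n) f)"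

lemma sets_M: "sets M = sets borel"
  using haar by (simp add: right_haar_measure_def)

lemma space_M: "space M = UNIV"
  using sets_eq_imp_space_eq[OF sets_M] by simp

lemma measurable_translate: "(\<lambda>x. x - a) \<in> measurable M M"
  unfolding measurable_cong_sets[OF sets_M sets_M]
  by (intro borel_measurable_continuous_onI continuous_intros)

lemma measurable_weight: "w \<in> borel_measurable M"
  unfolding measurable_cong_sets[OF sets_M refl]
  using weight by (intro borel_measurable_continuous_onI) (simp add: weight_def)

text \<open>The right invariance of the measure, as a fixed point property under push-forward.\<close>

lemma distr_translate: "distr M M (\<lambda>x. x - a) = M"
proof (rule measure_eqI)
  fix E assume "E \<in> sets (distr M M (\<lambda>x. x - a))"
  then have E: "E \<in> sets M"
    by simp
  have "(\<lambda>x. x - a) -` E \<inter> space M = (\<lambda>x. x + a) ` E"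
  proof -
    have "x \<in> (\<lambda>x. x + a) ` E" if "x - a \<in> E" for x
      using that by (intro image_eqI[of _ _ "x - a"]) auto
    then show ?thesis
      by (auto simp: space_M)
  qed
  then have "emeasure (distr M M (\<lambda>x. x - a)) E = emeasure M ((\<lambda>x. x + a) ` E)"
    using E measurable_translate by (simp add: emeasure_distr)
  also have "\<dots> = emeasure M E"
    using E haar by (simp add: right_haar_measure_def)
  finally show "emeasure (distr M M (\<lambda>x. x - a)) E = emeasure M E" .
qed simp

lemma shift_Lp_fun:
  assumes f: "f \<in> Lp_fun M p"
  shows "shift f \<in> Lp_fun M p"
proof -
  have meas: "(\<lambda>x. f (x - a)) \<in> borel_measurable M"
    using measurable_compose[OF measurable_translate Lp_fun_measurable[OF f]] .
  have "integrable (distr M M (\<lambda>x. x - a)) (\<lambda>x. norm (f x) powr p)"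
    unfolding distr_translate using f by (rule Lp_fun_integrable)
  from integrable_distr[OF measurable_translate this] have translate: "(\<lambda>x. f (x - a)) \<in> Lp_fun M p"
    using meas by (simp add: Lp_fun_def)
  obtain K where K: "\<And>x. \<bar>w x\<bar> \<le> K"
    using weight by (auto simp: weight_def bounded_iff)
  show ?thesis
  proof (rule dominated_Lp1(1)[OF translate])
    show "shift f \<in> borel_measurable M"
      unfolding shift_def using meas measurable_weight by simp
    show "0 \<le> K"
      using K abs_ge_zero order_trans by blast
    show "norm (shift f x) \<le> K * norm (f (x - a))" for x
      using K by (simp add: shift_def norm_mult mult_right_mono)
  qed
qed

lemma shift_pow_Lp_fun: "f \<in> Lp_fun M p \<Longrightarrow> (shift ^^ n) f \<in> Lp_fun M p"
  by (induction n) (auto intro: shift_Lp_fun)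

lemma T_cls:
  assumes f: "f \<in> Lp_fun M p"
  shows "T (cls f) = cls (shift f)"
  unfolding weighted_translation_def shift_def[symmetric]
proof (rule cls_of_subset)
  show "shift f \<in> shift ` cls f"
    using f by (auto simp: Lp_rel_iff)
  fix h assume "h \<in> shift ` cls f"
  then obtain g where g: "h = shift g" "g \<in> Lp_fun M p" "AE x in M. f x = g x"
    by (auto simp: Lp_rel_iff)
  have "AE x in distr M M (\<lambda>x. x - a). f x = g x"
    unfolding distr_translate by (rule g(3))
  then have "AE x in M. f (x - a) = g (x - a)"
    by (rule AE_distrD[OF measurable_translate])
  then have "AE x in M. shift f x = shift g x"
    by eventually_elim (simp add: shift_def)
  then show "h \<in> cls (shift f)"
    using f g by (simp add: Lp_rel_iff shift_Lp_fun)
qed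

lemma T_pow_cls: "f \<in> Lp_fun M p \<Longrightarrow> (T ^^ n) (cls f) = cls ((shift ^^ n) f)"
  by (induction n) (auto simp: T_cls shift_pow_Lp_fun)

lemma cls_in_X0_iff:
  assumes "f \<in> Lp_fun M p"
  shows "cls f \<in> X0 M p T A \<longleftrightarrow> (orbit_norm f \<longlongrightarrow> 0) (along A)"
  using assms Lp_fun_zero
  by (simp add: X0_def Lp_topology_def Lpm.limitin_metric T_pow_cls shift_pow_Lp_fun Lp_zero_cls
      Lp_dist_cls tendsto_iff)

lemma cls_in_DIV_pair_iff:
  assumes "f \<in> Lp_fun M p"
  shows "cls f \<in> DIV_pair M p T A B \<longleftrightarrow>
    (orbit_norm f \<longlongrightarrow> 0) (along A) \<and> filterlim (orbit_norm f) at_top (along B)"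
proof -
  have "DIV_pair M p T A B =
      {C \<in> X0 M p T A. filterlim (\<lambda>n. Lp_norm M p ((T ^^ n) C)) at_top (along B)}"
    by (auto simp: X0_def DIV_pair_def)
  then show ?thesis
    using assms by (simp add: cls_in_X0_iff T_pow_cls shift_pow_Lp_fun Lp_norm_cls)
qed

lemma X0_subset_Lp: "X0 M p T A \<subseteq> Lp M p"
  by (auto simp: X0_def)

lemma DIV_pair_subset_X0: "DIV_pair M p T A B \<subseteq> X0 M p T A"
  by (auto simp: X0_def DIV_pair_def)

lemma DIV_pair_subset_Lp: "DIV_pair M p T A B \<subseteq> Lp M p"
  by (auto simp: DIV_pair_def)

lemma DIV_subset_Lp: "DIV M p T \<subseteq> Lp M p"
  by (auto simp: DIV_def DIV_pair_def)

text \<open>The scalar is a product of weights and the point a translate of \<open>x\<close>; all that matters is that they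
  do not depend on \<open>f\<close>.\<close>

lemma shift_pow_pointwise: "\<exists>c y. 0 \<le> c \<and> (\<forall>f. (shift ^^ n) f x = of_real c * f y)"
proof (induction n arbitrary: x)
  case 0
  show ?case
    by (intro exI[of _ 1] exI[of _ x]) simp
next
  case (Suc n)
  obtain c y where c: "0 \<le> c" and cy: "\<And>f. (shift ^^ n) f (x - a) = of_real c * f y"
    using Suc by blast
  have "0 < w x"
    using weight by (simp add: weight_def)
  moreover have "(shift ^^ Suc n) f x = of_real (w x) * (shift ^^ n) f (x - a)" for f
    by (simp only: funpow.simps o_apply) (rule shift_apply)
  then have "(shift ^^ Suc n) f x = of_real (w x * c) * f y" for f
    by (simp add: cy del: funpow.simps)
  ultimately show ?case
    using c by (intro exI[of _ "w x * c"] exI[of _ y]) auto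
qed

lemma orbit_norm_dominated:
  assumes f: "f \<in> Lp_fun M p" and g: "g \<in> Lp_fun M p" and k: "k \<in> Lp_fun M p"
    and c: "0 \<le> c" "0 \<le> d"
    and le: "\<And>x. norm (k x) \<le> c * norm (f x) + d * norm (g x)"
  shows "orbit_norm k n \<le> c * orbit_norm f n + d * orbit_norm g n"
proof (rule dominated_Lp(2)[OF shift_pow_Lp_fun[OF f] shift_pow_Lp_fun[OF g] _ c])
  show "(shift ^^ n) k \<in> borel_measurable M"
    by (rule Lp_fun_measurable[OF shift_pow_Lp_fun[OF k]])
  fix x
  obtain e y where "0 \<le> e" and e: "\<And>f. (shift ^^ n) f x = of_real e * f y"
    using shift_pow_pointwise by blast
  then show "norm ((shift ^^ n) k x) \<le> c * norm ((shift ^^ n) f x) + d * norm ((shift ^^ n) g x)"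
    using mult_left_mono[OF le[of y] \<open>0 \<le> e\<close>] by (simp add: norm_mult algebra_simps)
qed

lemma X0_dominated:
  assumes f: "f \<in> Lp_fun M p" "cls f \<in> X0 M p T A"
    and g: "g \<in> Lp_fun M p" "cls g \<in> X0 M p T A"
    and k: "k \<in> borel_measurable M" and c: "0 \<le> c" "0 \<le> d"
    and le: "\<And>x. norm (k x) \<le> c * norm (f x) + d * norm (g x)"
  shows "k \<in> Lp_fun M p" and "cls k \<in> X0 M p T A"
proof -
  show kL: "k \<in> Lp_fun M p"
    by (rule dominated_Lp(1)[OF f(1) g(1) k c le])
  have "((\<lambda>n. c * orbit_norm f n + d * orbit_norm g n) \<longlongrightarrow> c * 0 + d * 0) (along A)"
    using f g by (intro tendsto_intros) (simp_all add: cls_in_X0_iff)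
  then have lim: "((\<lambda>n. c * orbit_norm f n + d * orbit_norm g n) \<longlongrightarrow> 0) (along A)"
    by simp
  have "(orbit_norm k \<longlongrightarrow> 0) (along A)"
    by (rule Lim_null_comparison[OF _ lim])
      (simp add: orbit_norm_dominated[OF f(1) g(1) kL c le])
  then show "cls k \<in> X0 M p T A"
    by (simp add: cls_in_X0_iff kL)
qed

text \<open>The upper bound keeps the orbit of \<open>k\<close> small along \<open>A\<close>, the lower bound forces it to infinity along
  \<open>B\<close>. Only moduli enter, whatever the phase of \<open>k\<close>.\<close>

lemma DIV_pair_squeeze:
  assumes f: "f \<in> Lp_fun M p" "cls f \<in> DIV_pair M p T A B"
    and g: "g \<in> Lp_fun M p" "cls g \<in> X0 M p T A"
    and k: "k \<in> borel_measurable M"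
    and c: "0 \<le> c" "0 \<le> d" "0 \<le> e"
    and le: "\<And>x. norm (k x) \<le> c * norm (f x) + d * norm (g x)"
    and ge: "\<And>x. norm (f x) \<le> e * norm (k x)"
  shows "k \<in> Lp_fun M p" and "cls k \<in> DIV_pair M p T A B"
proof -
  have fX: "cls f \<in> X0 M p T A"
    using f DIV_pair_subset_X0 by blast
  show kL: "k \<in> Lp_fun M p"
    by (rule X0_dominated(1)[OF f(1) fX g k c(1,2) le])
  have "(orbit_norm k \<longlongrightarrow> 0) (along A)"
    using X0_dominated(2)[OF f(1) fX g k c(1,2) le] by (simp add: cls_in_X0_iff kL)
  moreover have "filterlim (orbit_norm k) at_top (along B)"
  proof -
    \<comment> \<open>The constant is enlarged to \<open>e + 1\<close> so that it can be divided by.\<close>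
    have "orbit_norm f n \<le> (e + 1) * orbit_norm k n" for n
    proof -
      have "norm (f x) \<le> e * norm (k x) + 1 * norm (k x)" for x
        using add_increasing2[OF norm_ge_zero ge[of x], of "k x"] by simp
      from orbit_norm_dominated[OF kL kL f(1) c(3) zero_le_one this]
      show ?thesis
        by (simp add: algebra_simps)
    qed
    then have *: "orbit_norm f n / (e + 1) \<le> orbit_norm k n" for n
      using c by (simp add: pos_divide_le_eq mult.commute)
    have "filterlim (\<lambda>n. (1 / (e + 1)) * orbit_norm f n) at_top (along B)"
      using f c by (intro filterlim_tendsto_pos_mult_at_top[OF tendsto_const])
        (auto simp: cls_in_DIV_pair_iff)
    then show ?thesis
      by (rule filterlim_at_top_mono) (use * in auto)
  qed
  ultimately show "cls k \<in> DIV_pair M p T A B"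
    by (simp add: cls_in_DIV_pair_iff kL)
qed

section \<open>Density of irregular vectors\<close>

text \<open>A plain perturbation \<open>g + \<epsilon> f\<close> may fail, because the orbits of \<open>g\<close> and \<open>f\<close> can cancel along
  \<open>B\<close>. Adding \<open>\<epsilon>\<bar>f\<bar>\<close> with the sign of the real part of \<open>g\<close> excludes this at every point.\<close>

lemma X0_subset_closure_DIV_pair:
  assumes "DIV_pair M p T A B \<noteq> {}"
  shows "X0 M p T A \<subseteq> Lp_topology M p closure_of DIV_pair M p T A B"
proof
  obtain C where "C \<in> DIV_pair M p T A B"
    using assms by auto
  then obtain f where f: "f \<in> Lp_fun M p" "cls f \<in> DIV_pair M p T A B"
    using subset_LpE[OF _ DIV_pair_subset_Lp] by metis
  have fX: "cls f \<in> X0 M p T A"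
    using f DIV_pair_subset_X0 by blast
  fix C assume "C \<in> X0 M p T A"
  then obtain g where g: "g \<in> Lp_fun M p" "C = cls g" "cls g \<in> X0 M p T A"
    using subset_LpE[OF _ X0_subset_Lp] by metis
  have [measurable]: "f \<in> borel_measurable M" "g \<in> borel_measurable M"
    using f g by (auto intro: Lp_fun_measurable)
  have "\<exists>k \<in> Lp_fun M p. cls k \<in> DIV_pair M p T A B \<and> nrm (\<lambda>x. g x - k x) < r"
    if "0 < r" for r
  proof -
    define \<epsilon> where "\<epsilon> = r / (nrm f + 1)"
    have \<epsilon>: "0 < \<epsilon>" "\<epsilon> * nrm f < r"
      using \<open>0 < r\<close> unfolding \<epsilon>_def
      by (auto simp: add_nonneg_pos pos_divide_less_eq mult.commute)
    define k where "k x = g x + of_real ((if 0 \<le> Re (g x) then 1 else -1) * \<epsilon> * norm (f x))" for x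
    have k[measurable]: "k \<in> borel_measurable M"
      unfolding k_def by measurable
    have diff: "norm (g x - k x) = \<epsilon> * norm (f x)" for x
      using \<epsilon> by (auto simp: k_def norm_mult)
    have le: "norm (k x) \<le> \<epsilon> * norm (f x) + 1 * norm (g x)" for x
      using norm_triangle_ineq2[of "k x" "g x"] diff[of x] by (simp add: norm_minus_commute)
    have ge: "norm (f x) \<le> 1 / \<epsilon> * norm (k x)" for x
    proof -
      have "\<epsilon> * norm (f x) \<le> \<bar>Re (k x)\<bar>"
        using \<epsilon> by (auto simp: k_def abs_if)
      also have "\<dots> \<le> norm (k x)"
        by (rule abs_Re_le_cmod)
      finally show ?thesis
        using \<epsilon> by (simp add: field_simps)
    qed
    note k_DIV = DIV_pair_squeeze[OF f g(1,3) k _ _ _ le ge]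
    have "nrm (\<lambda>x. g x - k x) \<le> \<epsilon> * nrm f"
      using f diff \<epsilon> by (intro dominated_Lp1(2)) auto
    then show ?thesis
      using k_DIV \<epsilon> by (intro bexI[of _ k]) auto
  qed
  then show "C \<in> Lp_topology M p closure_of DIV_pair M p T A B"
    unfolding g(2) using in_closure_cls_iff[OF g(1) DIV_pair_subset_Lp] by blast
qed

lemma X0_subset_closure_DIV:
  assumes "C \<in> DIV M p T"
  obtains A where "C \<in> X0 M p T A" "X0 M p T A \<subseteq> Lp_topology M p closure_of DIV M p T"
proof -
  obtain A B where AB: "full_upper_density A" "full_upper_density B" "C \<in> DIV_pair M p T A B"
    using assms by (auto simp: DIV_def)
  then have "DIV_pair M p T A B \<subseteq> DIV M p T"
    by (auto simp: DIV_def)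
  then have "X0 M p T A \<subseteq> Lp_topology M p closure_of DIV M p T"
    using X0_subset_closure_DIV_pair[of A B] AB(3) closure_of_mono by (blast intro: order_trans)
  then show thesis
    using that AB(3) DIV_pair_subset_X0 by blast
qed

text \<open>As \<open>f\<close> is only a limit of irregular vectors, irregular \<open>h\<close> near \<open>f\<close> serve as bounds: clipping
  the modulus of \<open>g\<close> at \<open>K\<bar>h\<bar>\<close> gives a member of some \<open>X\<^sub>0\<^sub>,\<^sub>A\<close>, and costs at most
  \<open>K\<bar>f - h\<bar>\<close> pointwise.\<close>

lemma closure_DIV_dominated:
  assumes f: "f \<in> Lp_fun M p" "cls f \<in> Lp_topology M p closure_of DIV M p T"
    and g: "g \<in> borel_measurable M" and K: "0 \<le> K"
    and le: "\<And>x. norm (g x) \<le> K * norm (f x)"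
  shows "cls g \<in> Lp_topology M p closure_of DIV M p T"
proof -
  let ?cl = "Lp_topology M p closure_of DIV M p T"
  have cl_Lp: "?cl \<subseteq> Lp M p"
    by (rule closure_subset_Lp)
  have gL: "g \<in> Lp_fun M p"
    by (rule dominated_Lp1(1)[OF f(1) g K le])
  have "\<exists>k \<in> Lp_fun M p. cls k \<in> ?cl \<and> nrm (\<lambda>x. g x - k x) < r" if "0 < r" for r
  proof -
    have "0 < r / (K + 1)"
      using \<open>0 < r\<close> K by simp
    then obtain h where h: "h \<in> Lp_fun M p" "cls h \<in> DIV M p T"
      "nrm (\<lambda>x. f x - h x) < r / (K + 1)"
      using f in_closure_cls_iff[OF f(1) DIV_subset_Lp] by blast
    obtain A where A: "cls h \<in> X0 M p T A" "X0 M p T A \<subseteq> ?cl"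
      using X0_subset_closure_DIV[OF h(2)] by blast
    have [measurable]: "f \<in> borel_measurable M" "h \<in> borel_measurable M" "g \<in> borel_measurable M"
      using f h g by (auto intro: Lp_fun_measurable)
    define k where "k x = (if norm (g x) \<le> K * norm (h x) then g x
        else of_real (K * norm (h x) / norm (g x)) * g x)" for x
    have k[measurable]: "k \<in> borel_measurable M"
      unfolding k_def by measurable
    have k_le: "norm (k x) \<le> K * norm (h x) + 0 * norm (h x)" for x
    proof (cases "norm (g x) \<le> K * norm (h x)")
      case False
      then have "g x \<noteq> 0"
        using K by auto
      then show ?thesis
        using False K by (simp add: k_def norm_mult norm_divide)
    qed (simp add: k_def)
    have diff: "norm (g x - k x) \<le> K * norm (f x - h x)" for x
    proof (cases "norm (g x) \<le> K * norm (h x)")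
      case False
      then have "g x \<noteq> 0"
        using K by auto
      have ratio: "0 \<le> 1 - K * norm (h x) / norm (g x)"
        using False \<open>g x \<noteq> 0\<close> by (simp add: divide_le_eq)
      have "g x - k x = of_real (1 - K * norm (h x) / norm (g x)) * g x"
        using False by (simp add: k_def algebra_simps)
      then have "norm (g x - k x) = (1 - K * norm (h x) / norm (g x)) * norm (g x)"
        using ratio by (simp only: norm_mult norm_of_real abs_of_nonneg)
      also have "\<dots> = norm (g x) - K * norm (h x)"
        using \<open>g x \<noteq> 0\<close> by (simp add: left_diff_distrib)
      also have "\<dots> \<le> K * (norm (f x) - norm (h x))"
        using le[of x] by (simp add: algebra_simps)
      also have "\<dots> \<le> K * norm (f x - h x)"
        using K by (intro mult_left_mono norm_triangle_ineq2)
      finally show ?thesis .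
    qed (use K in \<open>simp add: k_def\<close>)
    have "nrm (\<lambda>x. g x - k x) \<le> K * nrm (\<lambda>x. f x - h x)"
      using diff_Lp[OF f(1) h(1)] K diff by (intro dominated_Lp1(2)) auto
    also have "\<dots> \<le> (K + 1) * nrm (\<lambda>x. f x - h x)"
      by (intro mult_right_mono) auto
    also have "\<dots> < r"
      using h(3) K by (simp add: pos_less_divide_eq mult.commute)
    finally show ?thesis
      using X0_dominated[OF h(1) A(1) h(1) A(1) k K _ k_le] A(2) by (intro bexI[of _ k]) auto
  qed
  then have "cls g \<in> Lp_topology M p closure_of ?cl"
    using in_closure_cls_iff[OF gL cl_Lp] by blast
  then show ?thesis
    by simp
qed

text \<open>Truncations of a function supported in \<open>supp f\<close> are dominated by multiples of \<open>f\<close>.\<close>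

lemma Lp_on_support_subset:
  assumes f: "f \<in> Lp_fun M p" "cls f \<in> Lp_topology M p closure_of DIV M p T"
  shows "Lp_on M p {x. f x \<noteq> 0} \<subseteq> Lp_topology M p closure_of DIV M p T"
proof
  let ?cl = "Lp_topology M p closure_of DIV M p T"
  have cl_Lp: "?cl \<subseteq> Lp M p"
    by (rule closure_subset_Lp)
  fix C assume C: "C \<in> Lp_on M p {x. f x \<noteq> 0}"
  then obtain g where g: "g \<in> Lp_fun M p" "C = cls g"
    by (auto simp: Lp_on_def elim: LpE)
  then have supp: "AE x in M. f x = 0 \<longrightarrow> g x = 0"
    using C by (auto simp: Lp_on_def Lp_rel_iff)
  define tr where "tr n x = (if norm (g x) \<le> real n * norm (f x) then g x else 0)" for n x
  have tr: "tr n \<in> Lp_fun M p" "(\<lambda>n. nrm (\<lambda>x. g x - tr n x)) \<longlonglongrightarrow> 0" for n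
    using truncation_tendsto[OF f(1) g(1) supp] by (simp_all add: tr_def[abs_def])
  have tr_cl: "cls (tr n) \<in> ?cl" for n
    by (rule closure_DIV_dominated[OF f Lp_fun_measurable[OF tr(1)], of "real n"])
      (auto simp: tr_def)
  have "\<exists>k \<in> Lp_fun M p. cls k \<in> ?cl \<and> nrm (\<lambda>x. g x - k x) < r" if "0 < r" for r
  proof -
    have "\<forall>\<^sub>F n in sequentially. nrm (\<lambda>x. g x - tr n x) < r"
      using order_tendstoD(2)[OF tr(2) \<open>0 < r\<close>] .
    then obtain n where "nrm (\<lambda>x. g x - tr n x) < r"
      by (auto simp: eventually_sequentially)
    then show ?thesis
      using tr(1) tr_cl by blast
  qed
  then have "C \<in> Lp_topology M p closure_of ?cl"
    unfolding g(2) using in_closure_cls_iff[OF g(1) cl_Lp] by blast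
  then show "C \<in> ?cl"
    by simp
qed

text \<open>Each class \<open>cls f\<close> in the closure lies in \<open>L\<^sup>p(supp f)\<close>, so the supports of the members of the
  closure form the required family.\<close>

lemma closure_DIV_union:
  "\<exists>\<M> \<subseteq> sets M. Lp_topology M p closure_of DIV M p T = (\<Union>M' \<in> \<M>. Lp_on M p M')"
proof -
  let ?cl = "Lp_topology M p closure_of DIV M p T"
  define \<M> where "\<M> = {{x. f x \<noteq> 0} | f. f \<in> Lp_fun M p \<and> cls f \<in> ?cl}"
  have "\<M> \<subseteq> sets M"
  proof
    fix Y assume "Y \<in> \<M>"
    then obtain f where f: "f \<in> Lp_fun M p" and Y: "Y = {x \<in> space M. f x \<noteq> 0}"
      by (auto simp: \<M>_def space_M)
    have [measurable]: "f \<in> borel_measurable M"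
      using f by (rule Lp_fun_measurable)
    show "Y \<in> sets M"
      unfolding Y by measurable
  qed
  moreover have "?cl \<subseteq> (\<Union>M' \<in> \<M>. Lp_on M p M')"
  proof
    fix C assume C: "C \<in> ?cl"
    then obtain f where f: "f \<in> Lp_fun M p" "C = cls f"
      by (rule subset_LpE[OF _ closure_subset_Lp])
    have "C \<in> Lp_on M p {x. f x \<noteq> 0}"
      using f by (auto simp: Lp_on_def Lp_rel_iff elim: eventually_mono)
    then show "C \<in> (\<Union>M' \<in> \<M>. Lp_on M p M')"
      using f C by (auto simp: \<M>_def)
  qed
  moreover have "(\<Union>M' \<in> \<M>. Lp_on M p M') \<subseteq> ?cl"
    using Lp_on_support_subset by (auto simp: \<M>_def)
  ultimately show ?thesis
    by (intro exI[of _ \<M>]) auto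
qed

section \<open>Connectedness\<close>

text \<open>Points of the segment are dominated by \<open>\<bar>f\<bar> + \<bar>g\<bar>\<close>; under the lower bound \<open>far\<close> the whole
  segment is irregular for the same pair of index sets.\<close>

lemma connected_component_segment:
  assumes f: "f \<in> Lp_fun M p" "cls f \<in> DIV_pair M p T A B"
    and g: "g \<in> Lp_fun M p" "cls g \<in> X0 M p T A"
    and far: "\<And>t x. 0 \<le> t \<Longrightarrow> t \<le> 1 \<Longrightarrow>
      norm (f x) \<le> 2 * norm (of_real (1 - t) * f x + of_real t * g x)"
  shows "connected_component_of (subtopology (Lp_topology M p) (DIV_pair M p T A B)) (cls f) (cls g)"
proof -
  define seg where "seg t = (\<lambda>x. of_real (1 - t) * f x + of_real t * g x)" for t :: real
  have "cls (seg t) \<in> DIV_pair M p T A B" if t: "0 \<le> t" "t \<le> 1" for t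
  proof (rule DIV_pair_squeeze(2)[OF f g, of _ 1 1 2])
    show "seg t \<in> borel_measurable M"
      unfolding seg_def using f(1) g(1) by (auto dest!: Lp_fun_measurable)
    fix x
    show "norm (f x) \<le> 2 * norm (seg t x)"
      unfolding seg_def by (rule far[OF t])
    have "norm (seg t x) \<le> (1 - t) * norm (f x) + t * norm (g x)"
      unfolding seg_def using t by (intro norm_triangle_le) (simp add: norm_mult flip: of_real_diff)
    also have "\<dots> \<le> 1 * norm (f x) + 1 * norm (g x)"
      using t by (intro add_mono mult_right_mono) auto
    finally show "norm (seg t x) \<le> 1 * norm (f x) + 1 * norm (g x)" .
  qed auto
  then have "connectedin (subtopology (Lp_topology M p) (DIV_pair M p T A B))
      ((\<lambda>t. cls (seg t)) ` {0..1})"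
    using segment_connected[OF f(1) g(1)] by (auto simp: connectedin_subtopology seg_def)
  moreover have "seg 0 = f" "seg 1 = g"
    by (auto simp: seg_def)
  then have "cls f \<in> (\<lambda>t. cls (seg t)) ` {0..1}" "cls g \<in> (\<lambda>t. cls (seg t)) ` {0..1}"
    by (metis atLeastAtMost_iff image_eqI order_refl zero_le_one)+
  ultimately show ?thesis
    unfolding connected_component_of_def by blast
qed

text \<open>Without the nonnegative cross term the squared modulus of a point of the segment is at least
  \<open>(1 - t)\<^sup>2 + t\<^sup>2 \<ge> 1/2\<close> times \<open>\<bar>u\<bar>\<^sup>2\<close>.\<close>

lemma norm_le_of_inner_nonneg:
  fixes u v :: complex
  assumes "0 \<le> inner u v" "norm u \<le> norm v" "0 \<le> t" "t \<le> 1"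
  shows "norm u \<le> 2 * norm (of_real (1 - t) * u + of_real t * v)"
proof -
  let ?z = "of_real (1 - t) * u + of_real t * v"
  have z: "?z = (1 - t) *\<^sub>R u + t *\<^sub>R v"
    by (simp add: scaleR_conv_of_real)
  have "1 \<le> 4 * ((1 - t)\<^sup>2 + t\<^sup>2)"
    using zero_le_power2[of "2 * t - 1"] by (simp add: power2_eq_square algebra_simps)
  from mult_right_mono[OF this zero_le_power2[of "norm u"]]
  have "(norm u)\<^sup>2 \<le> 4 * ((1 - t)\<^sup>2 + t\<^sup>2) * (norm u)\<^sup>2"
    by (simp only: mult_1)
  also have "\<dots> \<le> 4 * ((1 - t)\<^sup>2 * (norm u)\<^sup>2 + t\<^sup>2 * (norm v)\<^sup>2)"
    using assms by (simp add: algebra_simps power_mono mult_left_mono)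
  also have "\<dots> \<le> 4 * ((1 - t)\<^sup>2 * (norm u)\<^sup>2 + t\<^sup>2 * (norm v)\<^sup>2 + 2 * (1 - t) * t * inner u v)"
    using assms by simp
  also have "\<dots> = (2 * norm ?z)\<^sup>2"
    unfolding z power_mult_distrib power2_norm_eq_inner
    by (simp add: inner_left_distrib inner_right_distrib inner_commute algebra_simps power2_eq_square)
  finally show ?thesis
    by (rule power2_le_imp_le) simp
qed

text \<open>The segment from \<open>f\<close> to \<open>h\<close> may pass through zero where \<open>f\<close> is negative. The detour through
  \<open>\<plusminus>i h\<close>, with the sign of the imaginary part of \<open>f\<close>, never turns by more than a right angle.\<close>

lemma connected_component_majorant:
  assumes f: "f \<in> Lp_fun M p" "cls f \<in> DIV_pair M p T A B"
    and h: "h \<in> Lp_fun M p" "cls h \<in> X0 M p T A"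
    and real: "\<And>x. h x = of_real (norm (h x))" and le: "\<And>x. norm (f x) \<le> norm (h x)"
  shows "connected_component_of (subtopology (Lp_topology M p) (DIV_pair M p T A B)) (cls f) (cls h)"
proof -
  define q where "q x = (if 0 \<le> Im (f x) then \<i> else -\<i>) * h x" for x
  have [measurable]: "f \<in> borel_measurable M" "h \<in> borel_measurable M"
    using f h by (auto intro: Lp_fun_measurable)
  have q_meas: "q \<in> borel_measurable M"
    unfolding q_def by measurable
  have norm_q: "norm (q x) = norm (h x)" for x
    by (simp add: q_def norm_mult)
  have Re_h: "Re (h x) = norm (h x)" and Im_h: "Im (h x) = 0" for x
    using real[of x] by (metis Re_complex_of_real, metis Im_complex_of_real)
  have q: "q \<in> Lp_fun M p" "cls q \<in> DIV_pair M p T A B"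
    by (rule DIV_pair_squeeze[OF f h q_meas, of 0 1 1]; simp add: norm_q le)+
  have qX: "cls q \<in> X0 M p T A"
    using q(2) DIV_pair_subset_X0 by blast
  have "connected_component_of (subtopology (Lp_topology M p) (DIV_pair M p T A B)) (cls f) (cls q)"
    by (rule connected_component_segment[OF f q(1) qX], rule norm_le_of_inner_nonneg)
      (auto simp: norm_q le, auto simp: q_def inner_complex_def Re_h Im_h mult_nonpos_nonneg)
  moreover
  have "connected_component_of (subtopology (Lp_topology M p) (DIV_pair M p T A B)) (cls q) (cls h)"
    by (rule connected_component_segment[OF q h], rule norm_le_of_inner_nonneg)
      (auto simp: norm_q, auto simp: q_def inner_complex_def Re_h Im_h)
  ultimately show ?thesis
    by (rule connected_component_of_trans)
qed

lemma connectedin_DIV_pair: "connectedin (Lp_topology M p) (DIV_pair M p T A B)"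
proof -
  let ?S = "subtopology (Lp_topology M p) (DIV_pair M p T A B)"
  have "connected_component_of ?S C D"
    if C: "C \<in> DIV_pair M p T A B" and D: "D \<in> DIV_pair M p T A B" for C D
  proof -
    obtain f g where f: "f \<in> Lp_fun M p" "C = cls f" and g: "g \<in> Lp_fun M p" "D = cls g"
      using C D by (metis subset_LpE[OF _ DIV_pair_subset_Lp])
    have fX: "cls f \<in> X0 M p T A" "cls g \<in> X0 M p T A"
      using f g C D DIV_pair_subset_X0 by auto
    define h where "h x = complex_of_real (norm (f x) + norm (g x))" for x
    have norm_h: "norm (h x) = norm (f x) + norm (g x)" for x
      unfolding h_def norm_of_real by simp
    have [measurable]: "f \<in> borel_measurable M" "g \<in> borel_measurable M"
      using f g by (auto intro: Lp_fun_measurable)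
    have h_meas: "h \<in> borel_measurable M"
      unfolding h_def by measurable
    have h: "h \<in> Lp_fun M p" "cls h \<in> X0 M p T A"
      by (rule X0_dominated[OF f(1) fX(1) g(1) fX(2) h_meas, of 1 1]; simp add: norm_h)+
    have real: "h x = of_real (norm (h x))" for x
      unfolding norm_h by (rule h_def)
    have "connected_component_of ?S (cls f) (cls h)"
      by (rule connected_component_majorant[OF f(1) _ h real]) (use C f(2) norm_h in auto)
    moreover have "connected_component_of ?S (cls g) (cls h)"
      by (rule connected_component_majorant[OF g(1) _ h real]) (use D g(2) norm_h in auto)
    then have "connected_component_of ?S (cls h) (cls g)"
      by (simp only: connected_component_of_sym)
    ultimately show ?thesis
      unfolding f(2) g(2) by (rule connected_component_of_trans)
  qed
  then have "connected_space ?S"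
    by (auto simp: connected_space_iff_connected_component)
  then show ?thesis
    using DIV_pair_subset_Lp by (simp add: connectedin_def)
qed

end

section \<open>Closures and connectedness combined\<close>

theorem theorem3p15:
  fixes lam :: "'a::{topological_group_add, t2_space, second_countable_topology} measure"
    and p :: real
    and a :: 'a
    and w :: "'a \<Rightarrow> real"
    and A B :: "nat set"
    and M :: "'a set"
  assumes "locally_compact_space (euclidean :: 'a topology)"
    and "right_haar_measure lam"
    and "1 \<le> p"
    and "weight w"
    and "full_upper_density A"
    and "full_upper_density B"
    and "DIV_pair lam p (weighted_translation lam p a w) A B \<noteq> {}"
    and "M \<in> sets lam"
    and "Lp_topology lam p closure_of X0 lam p (weighted_translation lam p a w) A = Lp_on lam p M"
  shows "Lp_topology lam p closure_of DIV_left lam p (weighted_translation lam p a w) A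
           = Lp_topology lam p closure_of DIV_pair lam p (weighted_translation lam p a w) A B
       \<and> Lp_topology lam p closure_of DIV_pair lam p (weighted_translation lam p a w) A B
           = Lp_on lam p M
       \<and> Lp_on lam p M
           = Lp_topology lam p closure_of X0 lam p (weighted_translation lam p a w) A
       \<and> (\<exists>\<M> \<subseteq> sets lam.
            Lp_topology lam p closure_of DIV lam p (weighted_translation lam p a w)
              = (\<Union>M' \<in> \<M>. Lp_on lam p M'))
       \<and> connectedin (Lp_topology lam p)
           (DIV lam p (weighted_translation lam p a w) \<inter> Lp_on lam p M)"
proof -
  interpret weighted_shift lam p a w
    using assms by unfold_locales
  let ?X = "Lp_topology lam p"
  let ?D = "DIV_pair lam p T A B"
  have "?X closure_of ?D \<subseteq> ?X closure_of DIV_left lam p T A"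
    using assms(5,6) DIV_pair_subset_X0 by (intro closure_of_mono) (auto simp: DIV_left_def DIV_def)
  moreover have "?X closure_of DIV_left lam p T A \<subseteq> ?X closure_of X0 lam p T A"
    by (intro closure_of_mono) (auto simp: DIV_left_def)
  moreover have "?X closure_of X0 lam p T A \<subseteq> ?X closure_of ?D"
    by (rule closure_subset_closure[OF X0_subset_closure_DIV_pair[OF assms(7)]])
  ultimately have closures: "?X closure_of DIV_left lam p T A = ?X closure_of ?D"
      "?X closure_of ?D = Lp_on lam p M"
    using assms(9) by auto
  have "?D \<subseteq> Lp_on lam p M"
    unfolding closures(2)[symmetric] using DIV_pair_subset_Lp
    by (intro closure_of_subset) simp
  then have "connectedin ?X (DIV lam p T \<inter> Lp_on lam p M)"
    using assms(5,6) closures(2)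
    by (intro connectedin_intermediate_closure_of[OF connectedin_DIV_pair[of A B]])
      (auto simp: DIV_def)
  then show ?thesis
    using closures closure_DIV_union assms(9) by auto
qed

end
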